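(* Let $X\in\mathbb{R}^{d\times N}$, $Y\in\mathbb{R}^{d\times N}$, and $L\ge 0$. There exists a skew-symmetric matrix $Q\in\mathbb{R}^{d\times d}$ (i.e. $Q=-Q^T$) with $\sigma_{\max}(Q)\le L$ such that $Y=QX$ if, and only if, $$\begin{cases} X^TY=-Y^TX,\\ Y^TY\preceq L^2X^TX.\end{cases}$$
   Context: All matrices are real. $\sigma_{\max}(Q)$ denotes the largest singular value of $Q$, and $\preceq$ denotes the Löwner order on symmetric matrices ($A\preceq B$ iff $B-A$ is positive semidefinite). *)

theory Defs
  imports "HOL-Analysis.Analysis"
begin

definition eigenvalue_of :: "real^'n^'n \<Rightarrow> real \<Rightarrow> bool" where
  "eigenvalue_of A c \<longleftrightarrow> (\<exists>v. v \<noteq> 0 \<and> A *v v = c *\<^sub>R v)"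

text \<open>The singular values are the nonnegative square roots of the eigenvalues of the Gram
  matrix. Only square matrices are treated, so that no spurious zero can arise from a
  rectangular shape.\<close>

definition singular_values :: "real^'n^'n \<Rightarrow> real set" where
  "singular_values A = sqrt ` {c. eigenvalue_of (transpose A ** A) c}"

text \<open>The Gram matrix is symmetric and index types are nonempty, so the set below is
  finite and nonempty and \<^const>\<open>Max\<close> is a genuine maximum.\<close>

definition sigma_max :: "real^'n^'n \<Rightarrow> real" where
  "sigma_max A = Max (singular_values A)"

definition pos_semidef :: "real^'n^'n \<Rightarrow> bool" where
  "pos_semidef A \<longleftrightarrow> transpose A = A \<and> (\<forall>x. 0 \<le> x \<bullet> (A *v x))"

text \<open>Intended for symmetric arguments; on other matrices only the difference is
  constrained.\<close>

definition loewner_le :: "real^'n^'n \<Rightarrow> real^'n^'n \<Rightarrow> bool"  (infix "\<preceq>\<^sub>L" 50) where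
  "A \<preceq>\<^sub>L B \<longleftrightarrow> pos_semidef (B - A)"

definition skew_symmetric :: "real^'n^'n \<Rightarrow> bool" where
  "skew_symmetric Q \<longleftrightarrow> Q = - transpose Q"

end

theory Submission
  imports Defs
begin

text \<open>Sufficiency is an instance of Parrott's extension theorem. The conditions say that \<open>X x \<mapsto> Y x\<close>
  is a well-defined map on the range \<open>S\<close> of \<open>X\<close>, with skew compression to \<open>S\<close> and norm at
  most \<open>L\<close>. Skewness prescribes the \<open>S\<close>-component \<open>R\<close> of any skew extension on the whole space, and
  \<open>R\<close> has norm at most \<open>L\<close>. The remaining component \<open>Z\<close>, orthogonal to \<open>S\<close>, is bounded on \<open>S\<close> by
  the positive semidefinite form \<open>B = L\<^sup>2 - R\<^sup>T R\<close>; precomposing it with the \<open>B\<close>-orthogonal projection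
  onto \<open>S\<close> extends it to the whole space without violating that bound. The skew part of
  the resulting matrix still maps \<open>X\<close> to \<open>Y\<close> and still has norm at most \<open>L\<close>.\<close>

section \<open>Transposes and matrix algebra\<close>

lemma inner_matrix_vector_mult_left:
  fixes A :: "real^'n^'m"
  shows "(A *v x) \<bullet> y = x \<bullet> (transpose A *v y)"
  by (metis dot_lmul_matrix inner_commute vector_transpose_matrix)

lemma norm_matrix_vector_mult_sq:
  fixes A :: "real^'n^'m"
  shows "(norm (A *v x))\<^sup>2 = x \<bullet> ((transpose A ** A) *v x)"
  by (simp add: power2_norm_eq_inner inner_matrix_vector_mult_left matrix_vector_mul_assoc)

lemma transpose_add: "transpose (A + B) = transpose A + transpose (B :: 'a::plus^'n^'m)"
  by (simp add: transpose_def vec_eq_iff)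

lemma transpose_diff: "transpose (A - B) = transpose A - transpose (B :: 'a::minus^'n^'m)"
  by (simp add: transpose_def vec_eq_iff)

lemma transpose_minus: "transpose (- A) = - transpose (A :: 'a::uminus^'n^'m)"
  by (simp add: transpose_def vec_eq_iff)

lemma matrix_add_rdistrib: "(A + B) ** C = A ** C + B ** (C :: 'a::semiring_1^'p^'n)"
  by (simp add: vec_eq_iff matrix_matrix_mult_def distrib_right sum.distrib)

lemma matrix_diff_rdistrib: "(A - B) ** C = A ** C - B ** (C :: 'a::ring_1^'p^'n)"
  by (simp add: vec_eq_iff matrix_matrix_mult_def left_diff_distrib sum_subtractf)

lemma matrix_diff_ldistrib: "A ** (B - C) = A ** B - A ** (C :: 'a::ring_1^'p^'n)"
  by (simp add: vec_eq_iff matrix_matrix_mult_def right_diff_distrib sum_subtractf)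

lemma matrix_minus_left: "(- A) ** B = - (A ** (B :: 'a::ring_1^'p^'n))"
  by (simp add: vec_eq_iff matrix_matrix_mult_def sum_negf)

lemma matrix_minus_right: "A ** (- B) = - (A ** (B :: 'a::ring_1^'p^'n))"
  by (simp add: vec_eq_iff matrix_matrix_mult_def sum_negf)

lemma minus_matrix_vector_mult: "(- A) *v x = - (A *v (x :: 'a::ring_1^'n))"
  by (simp add: vec_eq_iff matrix_vector_mult_def sum_negf)

lemma mat_vector_mult: "mat c *v x = c *\<^sub>R (x :: real^'n)"
  by (simp add: vec_eq_iff matrix_vector_mult_def mat_def if_distrib[of "\<lambda>c. c * _"] cong: if_cong)

section \<open>Positive semidefinite forms and their projections\<close>

text \<open>The form attains its minimum 0 at \<open>v\<close>, so its first variation in the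
  direction \<open>C *v v\<close> vanishes; that variation is a multiple of the squared norm of
  \<open>C *v v\<close>.\<close>

lemma pos_semidef_inner_eq_0D:
  assumes "pos_semidef C" and "v \<bullet> (C *v v) = 0"
  shows "C *v v = 0"
proof -
  have nonneg: "0 \<le> x \<bullet> (C *v x)" for x
    using assms by (simp add: pos_semidef_def)
  define w where "w = C *v v"
  define a where "a = w \<bullet> w"
  define k where "k = w \<bullet> (C *v w)"
  have vw: "v \<bullet> (C *v w) = a"
    using assms inner_matrix_vector_mult_left[of C v w]
    by (simp add: a_def w_def pos_semidef_def)
  have "0 \<le> (v - t *\<^sub>R w) \<bullet> (C *v (v - t *\<^sub>R w))" for t
    by (rule nonneg)
  moreover have "(v - t *\<^sub>R w) \<bullet> (C *v (v - t *\<^sub>R w)) = t\<^sup>2 * k - 2 * t * a" for t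
    using assms(2) vw
    by (simp add: matrix_vector_mult_diff_distrib matrix_vector_mult_scaleR inner_diff_left
        inner_diff_right k_def power2_eq_square a_def algebra_simps flip: w_def)
  ultimately have quad: "0 \<le> t\<^sup>2 * k - 2 * t * a" for t
    by metis
  have k: "0 \<le> k"
    unfolding k_def by (rule nonneg)
  \<comment> \<open>The minimizer would be \<open>a / k\<close>; adding 1 avoids dividing by zero
    and still makes the quadratic equal to \<open>- (t^2 * (k + 2))\<close>.\<close>
  define t where "t = a / (k + 1)"
  have a: "a = t * (k + 1)"
    using k by (simp add: t_def)
  have "t\<^sup>2 * (k + 2) \<le> 0"
    using quad[of t] by (simp add: a algebra_simps power2_eq_square)
  then have "t = 0"
    using k by (smt (verit) mult_pos_pos zero_less_power2)
  then have "a = 0"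
    by (simp add: a)
  then show ?thesis
    by (simp add: a_def w_def)
qed

text \<open>The range of a symmetric \<open>G\<close> is the orthogonal complement of its kernel,
  and the columns of \<open>transpose M\<close> are orthogonal to the kernel of \<open>M\<close>,
  which contains that of \<open>G\<close>.\<close>

lemma symmetric_matrix_equation_solvable:
  fixes G :: "real^'n^'n" and M :: "real^'n^'m"
  assumes sym: "transpose G = G" and ker: "\<And>x. G *v x = 0 \<Longrightarrow> M *v x = 0"
  shows "\<exists>K :: real^'m^'n. G ** K = transpose M"
proof -
  have "\<exists>x. G *v x = column j (transpose M)" for j
  proof -
    let ?b = "column j (transpose M)"
    have sub: "subspace (range ((*v) G))"
      by (intro linear_subspace_image) (auto simp: matrix_vector_mul_linear)
    obtain y z where y: "y \<in> span (range ((*v) G))"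
      and z: "\<And>w. w \<in> span (range ((*v) G)) \<Longrightarrow> orthogonal z w" and b: "?b = y + z"
      using orthogonal_subspace_decomp_exists[of "range ((*v) G)" ?b] by metis
    \<comment> \<open>Being orthogonal to the range of \<open>G\<close>, \<open>z\<close> lies in
      the kernel of \<open>G\<close>.\<close>
    have "(G *v z) \<bullet> (G *v z) = z \<bullet> (G *v (G *v z))"
      using inner_matrix_vector_mult_left[of G z "G *v z"] sym by simp
    also have "\<dots> = 0"
      using z[of "G *v (G *v z)"] by (simp add: orthogonal_def span_base)
    finally have "M *v z = 0"
      using ker by simp
    then have "z \<bullet> ?b = 0"
      by (metis column_transpose inner_commute matrix_vector_mul_component row_def vec_lambda_eta zero_index)
    moreover have "z \<bullet> y = 0"
      using z[OF y] by (simp add: orthogonal_def)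
    ultimately have "z = 0"
      by (metis add_0 b inner_add_right inner_eq_zero_iff)
    then show ?thesis
      using y b sub by (metis add.right_neutral imageE span_eq_iff)
  qed
  then obtain f where f: "\<And>j. G *v f j = column j (transpose M)"
    by metis
  have "G ** (\<chi> i j. f j $ i) = transpose M"
    using f by (simp add: vec_eq_iff matrix_matrix_mult_def matrix_vector_mult_def column_def)
  then show ?thesis
    by blast
qed

text \<open>The equation says that \<open>v - X K v\<close> is \<open>B\<close>-orthogonal to the range of \<open>X\<close>. As \<open>B\<close> may be
  degenerate, \<open>X K\<close> need not fix that range; it does so modulo the kernel of \<open>B\<close>.\<close>

lemma pos_semidef_projection_exists:
  fixes X :: "real^'n^'m"
  assumes B: "pos_semidef B"
  obtains K :: "real^'m^'n"
  where "transpose X ** B ** X ** K = transpose X ** B"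
    and "\<And>v. (X *v (K *v v)) \<bullet> (B *v (X *v (K *v v))) \<le> v \<bullet> (B *v v)"
proof -
  have symB: "transpose B = B" and psd: "\<And>x. 0 \<le> x \<bullet> (B *v x)"
    using B by (auto simp: pos_semidef_def)
  let ?G = "transpose X ** B ** X"
  have "transpose ?G = ?G"
    by (simp add: matrix_transpose_mul symB matrix_mul_assoc)
  \<comment> \<open>Kernel inclusion that makes the normal equations solvable even when
    \<open>B\<close> or \<open>X\<close> is degenerate.\<close>
  moreover have "(B ** X) *v x = 0" if "?G *v x = 0" for x
  proof -
    have "(X *v x) \<bullet> (B *v (X *v x)) = x \<bullet> (?G *v x)"
      by (simp add: inner_matrix_vector_mult_left matrix_vector_mul_assoc matrix_mul_assoc)
    then have "B *v (X *v x) = 0"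
      using pos_semidef_inner_eq_0D[OF B] that by simp
    then show ?thesis
      by (simp add: matrix_vector_mul_assoc)
  qed
  ultimately obtain K where "?G ** K = transpose (B ** X)"
    using symmetric_matrix_equation_solvable by blast
  then have K: "?G ** K = transpose X ** B"
    by (simp add: matrix_transpose_mul symB)
  have "(X *v (K *v v)) \<bullet> (B *v (X *v (K *v v))) \<le> v \<bullet> (B *v v)" for v
  proof -
    let ?p = "X *v (K *v v)"
    have "?p \<bullet> (B *v ?p) = (K *v v) \<bullet> (transpose X *v (B *v ?p))"
      by (rule inner_matrix_vector_mult_left)
    also have "\<dots> = (K *v v) \<bullet> ((?G ** K) *v v)"
      by (simp add: matrix_vector_mul_assoc matrix_mul_assoc)
    also have "\<dots> = ?p \<bullet> (B *v v)"
      by (simp add: K inner_matrix_vector_mult_left flip: matrix_vector_mul_assoc)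
    finally have *: "?p \<bullet> (B *v ?p) = ?p \<bullet> (B *v v)" .
    have **: "v \<bullet> (B *v ?p) = ?p \<bullet> (B *v v)"
      using inner_matrix_vector_mult_left[of B v ?p] symB by (simp add: inner_commute)
    \<comment> \<open>Pythagoras for the form \<open>B\<close>: the residual \<open>v - ?p\<close>
      is \<open>B\<close>-orthogonal to \<open>?p\<close>.\<close>
    have "0 \<le> (v - ?p) \<bullet> (B *v (v - ?p))"
      by (rule psd)
    also have "\<dots> = v \<bullet> (B *v v) - ?p \<bullet> (B *v ?p)"
      using * ** by (simp add: matrix_vector_mult_diff_distrib inner_diff_left inner_diff_right)
    finally show ?thesis
      by simp
  qed
  with K show ?thesis
    using that by blast
qed

section \<open>Operator norm bounds and singular values\<close>

lemma norm_transpose_matrix_bound: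
  fixes A :: "real^'n^'m"
  assumes "\<And>v. norm (A *v v) \<le> L * norm v"
  shows "norm (transpose A *v w) \<le> L * norm w"
proof (cases "transpose A *v w = 0")
  case True
  \<comment> \<open>The sign of \<open>L\<close> is not assumed; testing the bound on a unit vector
    gives it.\<close>
  have "0 \<le> L * norm (axis undefined 1 :: real^'n)"
    using assms norm_ge_zero order_trans by blast
  with True show ?thesis
    by simp
next
  case False
  let ?u = "transpose A *v w"
  have "norm ?u * norm ?u = (A *v ?u) \<bullet> w"
    by (simp add: inner_matrix_vector_mult_left dot_square_norm power2_eq_square)
  also have "\<dots> \<le> norm (A *v ?u) * norm w"
    by (rule norm_cauchy_schwarz)
  also have "\<dots> \<le> L * norm ?u * norm w"
    by (intro mult_right_mono assms) auto
  finally show ?thesis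
    using False by (simp add: mult.commute mult.left_commute)
qed

lemma pos_semidef_bound_minus_gram:
  fixes A :: "real^'n^'m"
  assumes "\<And>v. norm (A *v v) \<le> L * norm v"
  shows "pos_semidef (mat (L\<^sup>2) - transpose A ** A)"
  unfolding pos_semidef_def
proof (intro conjI allI)
  show "transpose (mat (L\<^sup>2) - transpose A ** A) = mat (L\<^sup>2) - transpose A ** A"
    by (simp add: transpose_diff matrix_transpose_mul transpose_mat)
  fix x
  have "(norm (A *v x))\<^sup>2 \<le> (L * norm x)\<^sup>2"
    using assms by (intro power_mono) auto
  then show "0 \<le> x \<bullet> ((mat (L\<^sup>2) - transpose A ** A) *v x)"
    by (simp add: matrix_vector_mult_diff_rdistrib mat_vector_mult inner_diff_right
        power_mult_distrib power2_norm_eq_inner flip: norm_matrix_vector_mult_sq)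
qed

text \<open>Eigenvectors for distinct eigenvalues are orthogonal, and a set of nonzero pairwise
  orthogonal vectors is finite.\<close>

lemma finite_eigenvalues_symmetric:
  fixes A :: "real^'n^'n"
  assumes "transpose A = A"
  shows "finite {c. eigenvalue_of A c}"
proof -
  obtain f where f: "\<And>c. eigenvalue_of A c \<Longrightarrow> f c \<noteq> 0 \<and> A *v f c = c *\<^sub>R f c"
    using choice[of "\<lambda>c v. eigenvalue_of A c \<longrightarrow> v \<noteq> 0 \<and> A *v v = c *\<^sub>R v"]
    unfolding eigenvalue_of_def by blast
  let ?E = "{c. eigenvalue_of A c}"
  have orth: "f c \<bullet> f d = 0" if "c \<in> ?E" "d \<in> ?E" "c \<noteq> d" for c d
  proof -
    have "c * (f c \<bullet> f d) = d * (f c \<bullet> f d)"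
      using inner_matrix_vector_mult_left[of A "f c" "f d"] assms f that by simp
    with that show ?thesis
      by simp
  qed
  have "inj_on f ?E"
    using orth f by (intro inj_onI) (metis inner_eq_zero_iff mem_Collect_eq)
  moreover have "pairwise orthogonal (f ` ?E)"
    using orth by (auto simp: pairwise_def orthogonal_def)
  then have "finite (f ` ?E)"
    using f pairwise_orthogonal_imp_finite by blast
  ultimately show ?thesis
    using finite_imageD by blast
qed

text \<open>Let \<open>u\<close> maximize \<open>norm (A *v u)\<close> on the unit sphere, with
  value \<open>m\<close>. The positive semidefinite form of \<open>m^2 - transpose A ** A\<close>
  vanishes at \<open>u\<close>, so \<open>u\<close> is in its kernel.\<close>

lemma gram_top_eigenvalue_exists:
  fixes A :: "real^'n^'n"
  obtains m where "0 \<le> m" and "eigenvalue_of (transpose A ** A) (m\<^sup>2)"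
    and "\<And>v. norm (A *v v) \<le> m * norm v"
proof -
  have "compact (sphere (0 :: real^'n) 1)" "sphere (0 :: real^'n) 1 \<noteq> {}"
    by auto
  moreover have "continuous_on (sphere 0 1) (\<lambda>v. norm (A *v v))"
    by (intro continuous_intros)
  ultimately obtain u where u: "norm u = 1"
    and max: "\<And>v. norm v = 1 \<Longrightarrow> norm (A *v v) \<le> norm (A *v u)"
    using continuous_attains_sup[of "sphere 0 1" "\<lambda>v. norm (A *v v)"]
    by (metis mem_sphere_0)
  define m where "m = norm (A *v u)"
  have bound: "norm (A *v v) \<le> m * norm v" for v
  proof (cases "v = 0")
    case False
    then have "norm (A *v (v /\<^sub>R norm v)) \<le> m"
      unfolding m_def by (intro max) simp
    with False show ?thesis
      by (simp add: matrix_vector_mult_scaleR field_simps)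
  qed simp
  let ?C = "mat (m\<^sup>2) - transpose A ** A"
  have "u \<bullet> (?C *v u) = 0"
    using u
    by (simp add: mat_vector_mult matrix_vector_mult_diff_rdistrib inner_diff_right dot_square_norm m_def
        flip: norm_matrix_vector_mult_sq)
  then have "?C *v u = 0"
    by (rule pos_semidef_inner_eq_0D[OF pos_semidef_bound_minus_gram[OF bound]])
  then have "eigenvalue_of (transpose A ** A) (m\<^sup>2)"
    unfolding eigenvalue_of_def using u
    by (intro exI[of _ u]) (auto simp: mat_vector_mult matrix_vector_mult_diff_rdistrib)
  moreover have "0 \<le> m"
    by (simp add: m_def)
  ultimately show ?thesis
    using that bound by blast
qed

text \<open>The optimal bound \<open>m\<close> is itself a singular value, which gives one
  direction; for the other, the bound is tested on eigenvectors of the Gram matrix.\<close>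

lemma sigma_max_le_iff:
  fixes A :: "real^'n^'n"
  assumes "0 \<le> L"
  shows "sigma_max A \<le> L \<longleftrightarrow> (\<forall>v. norm (A *v v) \<le> L * norm v)"
proof -
  obtain m where m: "0 \<le> m" "eigenvalue_of (transpose A ** A) (m\<^sup>2)"
    and bound: "\<And>v. norm (A *v v) \<le> m * norm v"
    using gram_top_eigenvalue_exists[of A] by blast
  have fin: "finite (singular_values A)"
    unfolding singular_values_def
    by (intro finite_imageI finite_eigenvalues_symmetric) (simp add: matrix_transpose_mul)
  have "sqrt (m\<^sup>2) \<in> singular_values A"
    unfolding singular_values_def using m(2) by blast
  with m(1) have mem: "m \<in> singular_values A"
    by simp
  show ?thesis
  proof
    assume "sigma_max A \<le> L"
    then have "m \<le> L"
      using Max_ge[OF fin mem] by (simp add: sigma_max_def)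
    then show "\<forall>v. norm (A *v v) \<le> L * norm v"
      using bound by (meson mult_right_mono norm_ge_zero order_trans)
  next
    assume *: "\<forall>v. norm (A *v v) \<le> L * norm v"
    have "sqrt c \<le> L" if ev: "eigenvalue_of (transpose A ** A) c" for c
    proof -
      obtain v where v: "v \<noteq> 0" "(transpose A ** A) *v v = c *\<^sub>R v"
        using ev by (auto simp: eigenvalue_of_def)
      have "c * (norm v)\<^sup>2 = (norm (A *v v))\<^sup>2"
        using norm_matrix_vector_mult_sq[of A v] v by (simp add: power2_norm_eq_inner[of v])
      also have "\<dots> \<le> (L * norm v)\<^sup>2"
        using * by (intro power_mono) auto
      finally have "c \<le> L\<^sup>2"
        using v by (simp add: power_mult_distrib)
      with assms show ?thesis
        by (simp add: real_le_lsqrt real_sqrt_le_iff')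
    qed
    with fin mem show "sigma_max A \<le> L"
      unfolding sigma_max_def by (subst Max_le_iff) (auto simp: singular_values_def)
  qed
qed

section \<open>The Loewner condition as pointwise domination\<close>

lemma loewner_le_gram_iff:
  fixes X :: "real^'n^'m" and Y :: "real^'n^'p"
  assumes "0 \<le> L"
  shows "transpose Y ** Y \<preceq>\<^sub>L L\<^sup>2 *\<^sub>R (transpose X ** X) \<longleftrightarrow>
    (\<forall>x. norm (Y *v x) \<le> L * norm (X *v x))"
proof -
  have "x \<bullet> ((L\<^sup>2 *\<^sub>R (transpose X ** X) - transpose Y ** Y) *v x)
      = (L * norm (X *v x))\<^sup>2 - (norm (Y *v x))\<^sup>2" for x
    by (simp add: matrix_vector_mult_diff_rdistrib inner_diff_right power_mult_distrib
        norm_matrix_vector_mult_sq flip: scaleR_matrix_vector_assoc)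
  moreover have "transpose (L\<^sup>2 *\<^sub>R (transpose X ** X) - transpose Y ** Y)
      = L\<^sup>2 *\<^sub>R (transpose X ** X) - transpose Y ** Y"
    by (simp add: transpose_diff transpose_scalar matrix_transpose_mul)
  ultimately show ?thesis
    using assms by (simp add: loewner_le_def pos_semidef_def)
qed

text \<open>Domination puts the kernel of \<open>X\<close> inside the kernel of \<open>Y\<close>, so
  \<open>Y\<close> factors through \<open>X\<close>.\<close>

lemma dominated_matrix_mult_eq:
  fixes X :: "real^'n^'m" and Y :: "real^'n^'p"
  assumes dom: "\<And>x. norm (Y *v x) \<le> L * norm (X *v x)" and eq: "X ** A = X ** B"
  shows "Y ** A = Y ** B"
proof -
  have "Y *v (A *v v) = Y *v (B *v v)" for v
  proof -
    have "norm (Y *v (A *v v - B *v v)) \<le> L * norm (X *v (A *v v - B *v v))"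
      by (rule dom)
    also have "X *v (A *v v - B *v v) = 0"
      by (simp add: matrix_vector_mult_diff_distrib matrix_vector_mul_assoc eq)
    finally show ?thesis
      by (simp add: matrix_vector_mult_diff_distrib)
  qed
  then show ?thesis
    by (simp add: matrix_eq matrix_vector_mul_assoc)
qed

section \<open>Construction of the skew extension\<close>

lemma skew_extension_exists:
  fixes X Y :: "real^'n^'d"
  assumes L: "0 \<le> L" and skew: "transpose X ** Y = - (transpose Y ** X)"
    and dom: "\<And>x. norm (Y *v x) \<le> L * norm (X *v x)"
  shows "\<exists>Q. skew_symmetric Q \<and> (\<forall>v. norm (Q *v v) \<le> L * norm v) \<and> Y = Q ** X"
proof -
  \<comment> \<open>For the identity form, \<open>X ** W\<close> is the orthogonal projection onto
    the range of \<open>X\<close>, and \<open>Y ** W\<close> is the prescribed map on that range,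
    extended by zero.\<close>
  have "pos_semidef (mat 1 :: real^'d^'d)"
    by (simp add: pos_semidef_def transpose_mat)
  then obtain W :: "real^'d^'n" where W': "transpose X ** mat 1 ** X ** W = transpose X ** mat 1"
    and "\<And>v. (X *v (W *v v)) \<bullet> (mat 1 *v (X *v (W *v v))) \<le> v \<bullet> (mat 1 *v v)"
    using pos_semidef_projection_exists[of "mat 1" X] by metis
  then have normXW: "norm (X *v (W *v v)) \<le> norm v" for v
    by (simp add: norm_le)
  have W: "transpose X ** (X ** W) = transpose X"
    using W' by (simp add: matrix_mul_assoc)
  define P where "P = X ** W"
  have "transpose P ** P = transpose P"
    by (simp add: P_def matrix_transpose_mul W flip: matrix_mul_assoc)
  then have symP: "transpose P = P" and PP: "P ** P = P"
    by (metis matrix_transpose_mul transpose_transpose)+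
  have XP: "transpose X ** P = transpose X"
    by (simp add: W P_def)
  have PX: "P ** X = X"
    using XP symP by (metis matrix_transpose_mul transpose_transpose)
  have YWX: "Y ** W ** X = Y"
    using dominated_matrix_mult_eq[OF dom, of "W ** X" "mat 1"] PX
    by (simp add: P_def matrix_mul_assoc)
  have YWP: "Y ** W ** P = Y ** W"
    using dominated_matrix_mult_eq[OF dom, of "W ** P" W] PP
    by (simp add: P_def matrix_mul_assoc)

  \<comment> \<open>Forced choice: a skew \<open>Q\<close> with \<open>Q ** X = Y\<close> has
    \<open>Q ** P = Y ** W\<close>, and transposing gives \<open>P ** Q = R\<close>.\<close>
  define R where "R = - transpose (Y ** W)"
  have tR: "transpose R = - (Y ** W)"
    by (simp add: R_def transpose_minus)
  have normYW: "norm ((Y ** W) *v v) \<le> L * norm v" for v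
    using dom[of "W *v v"] mult_left_mono[OF normXW[of v] L]
    by (simp add: matrix_vector_mul_assoc)
  have normR: "norm (R *v v) \<le> L * norm v" for v
    using norm_transpose_matrix_bound[OF normYW] by (simp add: R_def minus_matrix_vector_mult)
  have RX: "R ** X = P ** Y"
  proof -
    have "R ** X = transpose W ** (- (transpose Y ** X))"
      by (simp add: R_def matrix_transpose_mul matrix_minus_left matrix_minus_right matrix_mul_assoc)
    also have "\<dots> = transpose P ** Y"
      by (simp add: P_def matrix_transpose_mul matrix_mul_assoc flip: skew)
    finally show ?thesis
      by (simp add: symP)
  qed

  define Z where "Z = Y - P ** Y"
  have PZ: "P ** Z = 0"
    by (simp add: Z_def matrix_diff_ldistrib matrix_mul_assoc PP)
  \<comment> \<open>\<open>Y ** W\<close> factors through \<open>P\<close>, so the range of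
    \<open>R\<close> lies in that of \<open>P\<close>, which is orthogonal to that of
    \<open>Z\<close>.\<close>
  have RZ: "transpose R ** Z = 0"
  proof -
    have "transpose R ** Z = - (Y ** W ** (P ** Z))"
      by (simp add: tR matrix_minus_left matrix_mul_assoc YWP)
    then show ?thesis
      by (simp add: PZ)
  qed
  have XZ: "transpose X ** Z = 0"
    by (metis PZ XP matrix_mul_assoc times0_right)
  have pyth: "(norm (R *v v + Z *v x))\<^sup>2 = (norm (R *v v))\<^sup>2 + (norm (Z *v x))\<^sup>2" for v x
  proof -
    have "(R *v v) \<bullet> (Z *v x) = v \<bullet> ((transpose R ** Z) *v x)"
      by (simp add: inner_matrix_vector_mult_left matrix_vector_mul_assoc)
    then show ?thesis
      by (simp add: RZ norm_add_Pythagorean orthogonal_def)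
  qed

  \<comment> \<open>The form of \<open>B\<close> is the room that \<open>R\<close> leaves under the
    bound \<open>L\<close> for the orthogonal component.\<close>
  define B where "B = mat (L\<^sup>2) - transpose R ** R"
  have B: "pos_semidef B"
    unfolding B_def by (rule pos_semidef_bound_minus_gram[OF normR])
  have formB: "v \<bullet> (B *v v) = (L * norm v)\<^sup>2 - (norm (R *v v))\<^sup>2" for v
    by (simp add: B_def matrix_vector_mult_diff_rdistrib mat_vector_mult inner_diff_right
        power_mult_distrib power2_norm_eq_inner flip: norm_matrix_vector_mult_sq)
  have normZ: "(norm (Z *v x))\<^sup>2 \<le> (X *v x) \<bullet> (B *v (X *v x))" for x
  proof -
    have "Y *v x = R *v (X *v x) + Z *v x"
      by (simp add: matrix_vector_mul_assoc RX Z_def matrix_vector_mult_diff_rdistrib)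
    then have "(norm (Y *v x))\<^sup>2 = (norm (R *v (X *v x)))\<^sup>2 + (norm (Z *v x))\<^sup>2"
      by (simp add: pyth)
    moreover have "(norm (Y *v x))\<^sup>2 \<le> (L * norm (X *v x))\<^sup>2"
      using dom by (intro power_mono) auto
    ultimately show ?thesis
      by (simp add: formB)
  qed
  obtain K :: "real^'d^'n" where K: "transpose X ** B ** X ** K = transpose X ** B"
    and normK: "\<And>v. (X *v (K *v v)) \<bullet> (B *v (X *v (K *v v))) \<le> v \<bullet> (B *v v)"
    using pos_semidef_projection_exists[OF B] by metis
  \<comment> \<open>\<open>X ** K ** X\<close> may differ from \<open>X\<close>, but the form of
    \<open>B\<close> vanishes on the difference, and \<open>normZ\<close> then makes the
    contribution of \<open>Z\<close> vanish too.\<close>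
  have ZKX: "Z ** K ** X = Z"
  proof -
    have "Z *v (K *v (X *v x) - x) = 0" for x
    proof -
      let ?y = "K *v (X *v x) - x"
      have "(X *v ?y) \<bullet> (B *v (X *v ?y)) = ?y \<bullet> ((transpose X ** B ** X) *v ?y)"
        by (simp add: inner_matrix_vector_mult_left matrix_vector_mul_assoc matrix_mul_assoc)
      also have "(transpose X ** B ** X) *v ?y = 0"
        by (simp add: matrix_vector_mult_diff_distrib matrix_vector_mul_assoc matrix_mul_assoc K)
      finally show ?thesis
        using normZ[of ?y] by simp
    qed
    then show ?thesis
      by (simp add: matrix_eq matrix_vector_mult_diff_distrib flip: matrix_vector_mul_assoc)
  qed

  define T where "T = R + Z ** K"
  have TX: "T ** X = Y"
    by (simp add: T_def matrix_add_rdistrib RX ZKX) (simp add: Z_def)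
  have normT: "norm (T *v v) \<le> L * norm v" for v
  proof -
    have "(norm (T *v v))\<^sup>2 = (norm (R *v v))\<^sup>2 + (norm (Z *v (K *v v)))\<^sup>2"
      by (simp add: T_def matrix_vector_mult_add_rdistrib pyth flip: matrix_vector_mul_assoc)
    also have "\<dots> \<le> (L * norm v)\<^sup>2"
      using normZ[of "K *v v"] normK[of v] formB[of v] by simp
    finally show ?thesis
      by (rule power2_le_imp_le) (simp add: L)
  qed
  \<comment> \<open>The range of \<open>Z\<close> is orthogonal to that of \<open>X\<close>, so only
    \<open>R\<close> contributes. Hence \<open>- transpose T\<close> also maps \<open>X\<close> to
    \<open>Y\<close>.\<close>
  have tTX: "transpose T ** X = - Y"
  proof -
    have "transpose (Z ** K) ** X = transpose (transpose X ** Z ** K)"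
      by (simp add: matrix_transpose_mul matrix_mul_assoc)
    also have "\<dots> = 0"
      by (simp add: XZ) (simp add: transpose_def vec_eq_iff)
    finally show ?thesis
      by (simp add: T_def transpose_add tR matrix_diff_rdistrib YWX)
  qed

  \<comment> \<open>Average of \<open>T\<close> and \<open>- transpose T\<close>, which both map
    \<open>X\<close> to \<open>Y\<close> and both satisfy the bound \<open>L\<close>.\<close>
  define Q where "Q = (1/2) *\<^sub>R (T - transpose T)"
  have "skew_symmetric Q"
    by (simp add: skew_symmetric_def Q_def transpose_def vec_eq_iff field_simps)
  moreover have "norm (Q *v v) \<le> L * norm v" for v
  proof -
    have "norm (Q *v v) = (1/2) * norm (T *v v - transpose T *v v)"
      by (simp add: Q_def matrix_vector_mult_diff_rdistrib flip: scaleR_matrix_vector_assoc)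
    also have "\<dots> \<le> (1/2) * (norm (T *v v) + norm (transpose T *v v))"
      by (intro mult_left_mono norm_triangle_ineq4) simp
    also have "\<dots> \<le> L * norm v"
      using normT[of v] norm_transpose_matrix_bound[OF normT, of v] by simp
    finally show ?thesis .
  qed
  moreover have "Y = Q ** X"
    by (simp add: Q_def matrix_diff_rdistrib TX tTX flip: scalar_matrix_assoc)
  ultimately show ?thesis
    by blast
qed

section \<open>Necessity, and both directions combined\<close>

theorem corollary3p2:
  fixes X Y :: "real^'N^'d" and L :: real
  assumes "L \<ge> 0"
  shows "(\<exists>Q :: real^'d^'d. skew_symmetric Q \<and> sigma_max Q \<le> L \<and> Y = Q ** X) \<longleftrightarrow>
    transpose X ** Y = - (transpose Y ** X) \<and>
    transpose Y ** Y \<preceq>\<^sub>L L\<^sup>2 *\<^sub>R (transpose X ** X)"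
proof
  assume "\<exists>Q :: real^'d^'d. skew_symmetric Q \<and> sigma_max Q \<le> L \<and> Y = Q ** X"
  then obtain Q :: "real^'d^'d" where Q: "Q = - transpose Q" "Y = Q ** X"
    and bound: "\<And>v. norm (Q *v v) \<le> L * norm v"
    using assms by (auto simp: skew_symmetric_def sigma_max_le_iff)
  have "transpose Y ** X = transpose X ** (transpose Q ** X)"
    by (simp add: Q(2) matrix_transpose_mul matrix_mul_assoc)
  also have "transpose Q = - Q"
    using Q(1) by (metis minus_minus)
  finally have "transpose X ** Y = - (transpose Y ** X)"
    by (simp add: Q(2) matrix_minus_left matrix_minus_right)
  moreover have "norm (Y *v x) \<le> L * norm (X *v x)" for x
    using bound[of "X *v x"] by (simp add: Q(2) matrix_vector_mul_assoc)
  ultimately show "transpose X ** Y = - (transpose Y ** X) \<and>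
      transpose Y ** Y \<preceq>\<^sub>L L\<^sup>2 *\<^sub>R (transpose X ** X)"
    using assms by (simp add: loewner_le_gram_iff)
next
  assume "transpose X ** Y = - (transpose Y ** X) \<and>
    transpose Y ** Y \<preceq>\<^sub>L L\<^sup>2 *\<^sub>R (transpose X ** X)"
  then show "\<exists>Q :: real^'d^'d. skew_symmetric Q \<and> sigma_max Q \<le> L \<and> Y = Q ** X"
    using assms skew_extension_exists[of L X Y] by (simp add: loewner_le_gram_iff sigma_max_le_iff)
qed

end
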